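(* Let $G$ be a split graph. Then $\overrightarrow{\chi}(G)\leq 2\omega(G)-2$.
   Context: An orientation $D$ of a graph $G$ replaces each edge by exactly one of its two possible arcs; $d^-_D(v)$ is the indegree of $v$. $D$ is proper if adjacent vertices have distinct indegrees; a $k$-orientation has maximum indegree at most $k$. $\overrightarrow{\chi}(G)$ is the minimum $k$ such that $G$ admits a proper $k$-orientation; $\omega(G)$ is the clique number. A split graph is a graph whose vertex set can be partitioned into a clique and an independent set. *)

theory Defs
  imports "Graph_Theory.Pair_Digraph"
begin

text \<open>
  A finite simple graph is a \<^locale>\<open>pair_graph\<close>, i.e. a finite, loopless, symmetric digraph without
  parallel arcs: the edge \<open>uv\<close> is represented by the two pairs \<open>(u, v)\<close> and \<open>(v, u)\<close>, which are
  also its two possible arcs in an orientation.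
\<close>

definition clique_in :: "'a pair_pre_digraph \<Rightarrow> 'a set \<Rightarrow> bool" where
  "clique_in G K \<longleftrightarrow> K \<subseteq> pverts G \<and> pairwise (\<lambda>u v. (u, v) \<in> parcs G) K"

definition independent_in :: "'a pair_pre_digraph \<Rightarrow> 'a set \<Rightarrow> bool" where
  "independent_in G I \<longleftrightarrow> I \<subseteq> pverts G \<and> pairwise (\<lambda>u v. (u, v) \<notin> parcs G) I"

definition clique_number :: "'a pair_pre_digraph \<Rightarrow> nat" where
  "clique_number G = Max (card ` {K. clique_in G K})"

text \<open>As usual for split graphs, either part may be empty.\<close>

definition split_graph :: "'a pair_pre_digraph \<Rightarrow> bool" where
  "split_graph G \<longleftrightarrow>
     (\<exists>K I. K \<union> I = pverts G \<and> K \<inter> I = {} \<and> clique_in G K \<and> independent_in G I)"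

definition orientation :: "'a pair_pre_digraph \<Rightarrow> 'a pair_pre_digraph \<Rightarrow> bool" where
  "orientation G D \<longleftrightarrow>
     pverts D = pverts G \<and> parcs D \<subseteq> parcs G \<and>
     (\<forall>(u, v) \<in> parcs G. (u, v) \<in> parcs D \<longleftrightarrow> (v, u) \<notin> parcs D)"

definition k_orientation :: "nat \<Rightarrow> 'a pair_pre_digraph \<Rightarrow> 'a pair_pre_digraph \<Rightarrow> bool" where
  "k_orientation k G D \<longleftrightarrow> orientation G D \<and> (\<forall>v \<in> pverts G. in_degree D v \<le> k)"

definition proper :: "'a pair_pre_digraph \<Rightarrow> 'a pair_pre_digraph \<Rightarrow> bool" where
  "proper G D \<longleftrightarrow> (\<forall>(u, v) \<in> parcs G. in_degree D u \<noteq> in_degree D v)"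

text \<open>
  Since \<^term>\<open>Least P\<close> is unspecified for an unsatisfiable \<open>P\<close>, an upper bound on this number
  can only be derived once some proper orientation of \<open>G\<close> is known to exist.
\<close>

definition proper_orientation_number :: "'a pair_pre_digraph \<Rightarrow> nat" where
  "proper_orientation_number G = (LEAST k. \<exists>D. k_orientation k G D \<and> proper G D)"

end

theory Submission
  imports Defs "HOL-Library.Infinite_Set"
begin

text \<open>
  Partition the graph into a clique \<open>K\<close> and an independent set \<open>I\<close> such that no vertex of \<open>I\<close> is
  adjacent to all of \<open>K\<close>; let \<open>n = |K|\<close> and let \<open>d v\<close> be the number of neighbours of \<open>v \<in> K\<close>
  in \<open>I\<close>. Orient \<open>K\<close> as a transitive tournament that lists the vertices \<open>B\<close> with \<open>d v \<ge> n\<close> first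
  and then the remaining vertices \<open>A\<close> by increasing \<open>d v\<close>. Vertices in \<open>A\<close> receive all their
  edges from \<open>I\<close>, so their indegrees are distinct, and exceed \<open>|B|\<close> if \<open>d v > 0\<close>. Hence vertices
  in \<open>I\<close> have indegree at most \<open>c = min |B| (n - 1)\<close>. The source of the tournament, if it lies in
  \<open>B\<close>, keeps indegree 0, while all its neighbours get positive indegree. The other vertices of \<open>B\<close>
  have enough neighbours in \<open>I\<close> to be raised to distinct values above \<open>c\<close> that avoid those
  of \<open>A\<close>.
\<close>

text \<open>An element of maximal key can take the last rank, and ties are broken arbitrarily. The
  ranks will direct the tournament on the clique.\<close>

lemma exists_rank_monotone_key:
  fixes key :: "'a \<Rightarrow> nat"
  assumes "finite K"
  shows "\<exists>r. bij_betw r K {..<card K} \<and> (\<forall>u\<in>K. \<forall>v\<in>K. key u < key v \<longrightarrow> r u < r v)"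
  using assms
proof (induction "card K" arbitrary: K)
  case 0
  then show ?case by (simp add: bij_betw_def)
next
  case (Suc n)
  then have "K \<noteq> {}" by auto
  then have "Max (key ` K) \<in> key ` K" using \<open>finite K\<close> by (intro Max_in) auto
  then obtain x where x: "x \<in> K" "Max (key ` K) = key x" by auto
  have max: "key v \<le> key x" if "v \<in> K" for v
    unfolding x(2)[symmetric] using that \<open>finite K\<close> by simp
  have card: "card (K - {x}) = n" using x Suc by simp
  then obtain r where r: "bij_betw r (K - {x}) {..<n}"
    "\<forall>u\<in>K - {x}. \<forall>v\<in>K - {x}. key u < key v \<longrightarrow> r u < r v"
    using Suc.hyps(1)[of "K - {x}"] Suc.prems by auto
  let ?r = "r(x := n)"
  have "bij_betw ?r (K - {x}) {..<n}"
    using r(1) by (subst bij_betw_cong[where g = r]) auto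
  then have "bij_betw ?r (insert x (K - {x})) (insert n {..<n})"
    by (intro bij_betw_combine[of _ "{x}" "{n}", simplified]) (auto simp: bij_betw_def)
  then have 1: "bij_betw ?r K {..<card K}"
    using x unfolding Suc.hyps(2)[symmetric] lessThan_Suc by (simp add: insert_absorb)
  have 2: "?r u < ?r v" if "u \<in> K" "v \<in> K" "key u < key v" for u v
  proof -
    have "u \<noteq> x" using max[OF that(2)] that(3) by auto
    moreover have "r u < n" using that \<open>u \<noteq> x\<close> r(1) by (auto simp: bij_betw_def)
    ultimately show ?thesis using that r(2) by auto
  qed
  show ?case using 1 2 by blast
qed

text \<open>Ranks fill an initial segment of the naturals without gaps. So \<open>r v\<close> is the
  indegree that \<open>v\<close> receives inside the tournament.\<close>

lemma rank_eq_card_smaller: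
  assumes "bij_betw r K {..<card K}" "v \<in> K"
  shows "card {u \<in> K. r u < r v} = r v"
proof -
  have "r ` {u \<in> K. r u < r v} = {..<r v}"
  proof -
    have "r v < card K" using assms by (auto simp: bij_betw_def)
    then have "\<exists>u\<in>K. r u = i" if "i < r v" for i
      using assms that unfolding bij_betw_def by (metis imageE lessThan_iff less_trans)
    then show ?thesis by force
  qed
  moreover have "inj_on r {u \<in> K. r u < r v}"
    using assms by (auto simp: bij_betw_def inj_on_def)
  ultimately show ?thesis by (metis card_image card_lessThan)
qed

text \<open>Enumerate the numbers above \<open>c\<close> outside \<open>V\<close> in increasing
  order: each number strictly between \<open>c\<close> and the value at \<open>k\<close> lies in
  \<open>V\<close> or is one of the \<open>k\<close> earlier values.\<close>

lemma exists_injection_avoiding: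
  fixes V :: "nat set"
  assumes "finite V"
  obtains f :: "nat \<Rightarrow> nat"
  where "inj f" "\<And>k. f k \<notin> V" "\<And>k. c < f k" "\<And>k. f k \<le> c + card V + k + 1"
proof -
  define S where "S = {x. c < x \<and> x \<notin> V}"
  have "S = UNIV - ({..c} \<union> V)" by (auto simp: S_def)
  then have inf: "infinite S" using assms by (simp add: Diff_infinite_finite)
  let ?f = "enumerate S"
  have mem: "?f k \<in> S" for k using inf by (rule enumerate_in_set)
  have "?f k \<le> c + card V + k + 1" for k
  proof -
    have "{c<..<?f k} \<subseteq> V \<union> ?f ` {..<k}"
    proof
      fix x assume x: "x \<in> {c<..<?f k}"
      show "x \<in> V \<union> ?f ` {..<k}"
      proof (cases "x \<in> V")
        case False
        then have "x \<in> S" using x by (simp add: S_def)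
        then obtain j where "?f j = x" using enumerate_Ex[OF inf] by blast
        moreover have "j < k" using x calculation inf by (metis enumerate_mono_iff greaterThanLessThan_iff)
        ultimately show ?thesis by auto
      qed simp
    qed
    then have "card {c<..<?f k} \<le> card (V \<union> ?f ` {..<k})"
      by (rule card_mono[rotated]) (simp add: assms)
    also have "\<dots> \<le> card V + card (?f ` {..<k})" by (rule card_Un_le)
    also have "\<dots> \<le> card V + k" using card_image_le[of "{..<k}" ?f] by simp
    finally show ?thesis by simp
  qed
  moreover have "inj ?f" using inf by (simp add: strict_mono_enumerate strict_mono_imp_inj_on)
  ultimately show ?thesis using that mem unfolding S_def by blast
qed

section \<open>Target indegrees\<close>

text \<open>
  The map \<open>r\<close> ranks the vertices of the tournament on \<open>K\<close>, and \<open>X v\<close> consists of those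
  neighbours of \<open>v\<close> in \<open>I\<close> whose edge is directed towards \<open>v\<close>; the last cardinality is the
  resulting indegree of \<open>u \<in> I\<close>.
\<close>

lemma exists_indegree_targets:
  fixes N :: "'a \<Rightarrow> 'b set"
  assumes K: "finite K" and N: "\<And>v. v \<in> K \<Longrightarrow> finite (N v)"
    and incomplete: "\<And>u v. v \<in> K \<Longrightarrow> u \<in> N v \<Longrightarrow> \<exists>w\<in>K. u \<notin> N w"
  obtains r X where "bij_betw r K {..<card K}" "\<And>v. v \<in> K \<Longrightarrow> X v \<subseteq> N v"
    "inj_on (\<lambda>v. r v + card (X v)) K"
    "\<And>v. v \<in> K \<Longrightarrow> r v + card (X v) \<le> 2 * card K - 2"
    "\<And>v u. v \<in> K \<Longrightarrow> u \<in> N v \<Longrightarrow> r v + card (X v) \<noteq> card {w \<in> K. u \<in> N w - X w}"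
proof -
  define n where "n = card K"
  define d where "d v = card (N v)" for v
  define A where "A = {v \<in> K. d v < n}"
  define B where "B = {v \<in> K. n \<le> d v}"
  define c where "c = min (card B) (n - 1)"
  have AB: "K = A \<union> B" "A \<inter> B = {}" by (auto simp: A_def B_def)
  have fin: "finite A" "finite B" using K by (auto simp: A_def B_def)
  have n: "n = card A + card B" unfolding n_def using AB fin by (simp add: card_Un_disjoint)
  \<comment> \<open>The \<open>Suc\<close> keeps key 0 for \<open>B\<close>, so that
    \<open>B\<close> also precedes vertices of \<open>A\<close> with \<open>d v = 0\<close>.\<close>
  obtain r where bij: "bij_betw r K {..<n}" and mono: "\<And>u v. u \<in> K \<Longrightarrow> v \<in> K \<Longrightarrow>
      (if u \<in> B then 0 else Suc (d u)) < (if v \<in> B then 0 else Suc (d v)) \<Longrightarrow> r u < r v"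
    using exists_rank_monotone_key[OF K, of "\<lambda>v. if v \<in> B then 0 else Suc (d v)"]
    unfolding n_def by blast
  have rless: "r v < n" if "v \<in> K" for v
    using bij that by (auto simp: bij_betw_def)
  have inj: "inj_on r K" using bij by (simp add: bij_betw_def)
  have smaller: "card {u \<in> K. r u < r v} = r v" if "v \<in> K" for v
    using rank_eq_card_smaller[of r K v] bij that by (simp add: n_def)
  have notB: "v \<notin> B" if "v \<in> A" for v using that AB(2) by blast
  have inK: "v \<in> A \<Longrightarrow> v \<in> K" "v \<in> B \<Longrightarrow> v \<in> K" for v using AB(1) by blast+
  have BA: "r u < r v" if "u \<in> B" "v \<in> A" for u v
    using mono[of u v] that notB inK by simp
  have AA: "r u < r v" if "u \<in> A" "v \<in> A" "d u < d v" for u v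
    using mono[of u v] that notB inK by simp
  have rA: "card B \<le> r v" if "v \<in> A" for v
  proof -
    have "B \<subseteq> {u \<in> K. r u < r v}" using BA that inK by blast
    then have "card B \<le> card {u \<in> K. r u < r v}" using K by (intro card_mono) simp_all
    then show ?thesis using smaller inK that by simp
  qed
  have rB: "r v < card B" if "v \<in> B" for v
  proof -
    have "u \<in> B" if "u \<in> K" "r u < r v" for u
      using BA[OF \<open>v \<in> B\<close>, of u] that AB(1) by force
    then have "{u \<in> K. r u < r v} \<subset> B" using that by blast
    then have "card {u \<in> K. r u < r v} < card B" using fin by (intro psubset_card_mono)
    then show ?thesis using smaller inK that by simp
  qed
  define V where "V = (\<lambda>v. r v + d v) ` A"
  have V: "finite V" "card V \<le> card A" using fin by (auto simp: V_def card_image_le)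
  obtain f where f: "inj f" "\<And>k. f k \<notin> V" "\<And>k. c < f k" "\<And>k. f k \<le> c + card V + k + 1"
    using exists_injection_avoiding[OF V(1)] by blast
  \<comment> \<open>The target indegree. Rank 0 in \<open>B\<close> bypasses \<open>f\<close>, hence
    the shift of the index by one.\<close>
  define t where "t v = (if v \<in> A then r v + d v else if r v = 0 then 0 else f (r v - 1))" for v
  have c: "card B \<le> c + 1" "c + card A \<le> n" "c \<le> n - 1" "c \<le> card B"
    using n by (auto simp: c_def)
  have fB: "f (r v - 1) \<le> c + card A + r v" "r v \<le> f (r v - 1)" if "v \<in> B" "r v \<noteq> 0" for v
    using f(4)[of "r v - 1"] f(3)[of "r v - 1"] that V rB[OF that(1)] c by linarith+
  \<comment> \<open>The tournament supplies \<open>r v\<close>, so \<open>N v\<close> must supply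
    \<open>t v - r v\<close>. For \<open>v\<close> in \<open>B\<close> of nonzero rank this is at
    most \<open>c + card A\<close>, hence at most \<open>n\<close> and thus at most
    \<open>d v\<close>.\<close>
  have "\<exists>Y. Y \<subseteq> N v \<and> r v + card Y = t v" if "v \<in> K" for v
  proof -
    have "r v \<le> t v \<and> t v - r v \<le> card (N v)"
    proof (cases "v \<in> A")
      case True
      then show ?thesis by (simp add: t_def d_def)
    next
      case False
      then have "v \<in> B" using that AB by auto
      then show ?thesis using fB[of v] False c by (auto simp: t_def B_def d_def)
    qed
    then show ?thesis
      using obtain_subset_with_card_n[of "t v - r v" "N v"] by (metis le_add_diff_inverse)
  qed
  then obtain X where X: "\<And>v. v \<in> K \<Longrightarrow> X v \<subseteq> N v" "\<And>v. v \<in> K \<Longrightarrow> r v + card (X v) = t v"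
    by metis
  have XA: "X v = N v" if "v \<in> A" for v
  proof -
    have "v \<in> K" using that AB by auto
    then show ?thesis
      using X[of v] that N card_subset_eq[of "N v" "X v"] by (auto simp: t_def d_def)
  qed
  have less_t: "u \<in> K \<Longrightarrow> v \<in> K \<Longrightarrow> r u < r v \<Longrightarrow> t u \<noteq> t v" for u v
  proof -
    assume uv: "u \<in> K" "v \<in> K" "r u < r v"
    consider "v \<in> A" "u \<in> A" | "v \<in> B" "u \<in> A" | "v \<in> A" "u \<in> B" | "v \<in> B" "u \<in> B"
      using uv AB by auto
    then show "t u \<noteq> t v"
    proof cases
      case 1
      then have "\<not> d v < d u" using AA[of v u] uv by auto
      then show ?thesis using uv 1 by (simp add: t_def)
    next
      case 2
      then show ?thesis using BA[of v u] uv by simp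
    next
      case 3
      then have "t v \<in> V" by (auto simp: t_def V_def)
      \<comment> \<open>Avoiding \<open>V\<close> says nothing about the target 0 of the source; the
        positive rank of \<open>v\<close> rules out that collision.\<close>
      moreover have "t v > 0" using 3 uv by (simp add: t_def)
      moreover have "t u = 0 \<or> t u \<notin> V" using 3(2) notB[of u] f(2) by (auto simp: t_def)
      ultimately show ?thesis by auto
    next
      case 4
      then have "u \<notin> A" "v \<notin> A" using AB by auto
      moreover have "f (r v - 1) \<noteq> 0" using f(3)[of "r v - 1"] by linarith
      moreover have "r u \<noteq> 0 \<Longrightarrow> f (r u - 1) \<noteq> f (r v - 1)" 
        using inj_eq[OF f(1), of "r u - 1" "r v - 1"] uv(3) by auto
      ultimately show ?thesis using uv(3) unfolding t_def by auto
    qed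
  qed
  have "inj_on t K"
  proof (rule inj_onI)
    fix u v assume "u \<in> K" "v \<in> K" "t u = t v"
    then have "r u = r v" using less_t[of u v] less_t[of v u] by fastforce
    then show "u = v" using inj \<open>u \<in> K\<close> \<open>v \<in> K\<close> by (simp add: inj_on_eq_iff)
  qed
  then have injt: "inj_on (\<lambda>v. r v + card (X v)) K"
    using X(2) by (subst inj_on_cong[where g = t]) auto
  have bound: "t v \<le> 2 * n - 2" if "v \<in> K" for v
  proof (cases "v \<in> A")
    case True
    then have "d v < n" by (simp add: A_def)
    then show ?thesis using True rless[OF that] by (simp add: t_def)
  next
    case False
    then have "v \<in> B" using that AB by auto
    then have "r v < card B" by (rule rB)
    \<comment> \<open>For nonzero rank, the bound \<open>c + card A + r v\<close> splits into
      \<open>c\<close>, at most \<open>n - 1\<close>, and \<open>card A + r v\<close>, at most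
      \<open>card A + card B - 1 = n - 1\<close>.\<close>
    then show ?thesis using False fB(1)[OF \<open>v \<in> B\<close>] c n by (auto simp: t_def)
  qed
  have proper: "t v \<noteq> card {w \<in> K. u \<in> N w - X w}" if v: "v \<in> K" "u \<in> N v" for v u
  proof -
    let ?W = "{w \<in> K. u \<in> N w - X w}"
    \<comment> \<open>Vertices of \<open>A\<close> absorb all their edges from the independent side,
      so only \<open>B\<close> can send an arc to \<open>u\<close>.\<close>
    have "?W \<subseteq> B" using XA AB by auto
    then have "card ?W \<le> card B" using fin by (simp add: card_mono)
    moreover have "?W \<subset> K" using incomplete[OF v] by auto
    then have "card ?W < n" unfolding n_def using K by (rule psubset_card_mono[rotated])
    ultimately have W: "card ?W \<le> c" by (auto simp: c_def)
    show ?thesis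
    proof (cases "v \<in> A")
      case True
      \<comment> \<open>The neighbour \<open>u\<close> itself makes this positive, which lifts
        \<open>t v\<close> strictly above \<open>card B\<close>.\<close>
      have "d v > 0" using v N by (auto simp: d_def card_gt_0_iff)
      then have "t v > card B" using rA[OF True] True by (simp add: t_def)
      then show ?thesis using W c by simp
    next
      case False
      show ?thesis
      proof (cases "r v = 0")
        case True
        \<comment> \<open>Target 0 leaves \<open>X v\<close> empty, so \<open>v\<close> sends an arc
          to \<open>u\<close>, whose indegree is then positive.\<close>
        then have "t v = 0" using False by (simp add: t_def)
        then have "card (X v) = 0" using X(2)[OF v(1)] by simp
        moreover have "finite (X v)" using X(1) N v by (meson finite_subset)
        ultimately have "v \<in> ?W" using v by simp
        then have "card ?W > 0" using K by (auto simp: card_gt_0_iff)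
        then show ?thesis using \<open>t v = 0\<close> by simp
      next
        case nz: False
        then have "t v > c" using f(3) False by (simp add: t_def)
        then show ?thesis using W by simp
      qed
    qed
  qed
  show ?thesis
    using that[of r X] bij X injt bound proper unfolding n_def by simp
qed

section \<open>Orienting the split graph\<close>

lemma in_degree_eq_card:
  "in_degree (with_proj D) v = card {u. (u, v) \<in> parcs D}"
proof -
  have "in_arcs (with_proj D) v = (\<lambda>u. (u, v)) ` {u. (u, v) \<in> parcs D}"
    by (auto simp: in_arcs_def)
  then show ?thesis by (simp add: in_degree_def card_image inj_on_def)
qed

lemma exists_proper_orientation_of_split:
  assumes "pair_graph G" and part: "K \<union> I = pverts G" "K \<inter> I = {}"
    and clique: "clique_in G K" and indep: "independent_in G I"
    and incomplete: "\<And>u. u \<in> I \<Longrightarrow> \<exists>w\<in>K. (u, w) \<notin> parcs G"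
  shows "\<exists>D. k_orientation (2 * card K - 2) G D \<and> proper G D"
proof -
  interpret pair_graph G by fact
  have sym: "(u, v) \<in> parcs G \<Longrightarrow> (v, u) \<in> parcs G" for u v
    using arcs_symmetric by blast
  have finK: "finite K" and finI: "finite I"
    using part finite_verts by (metis finite_Un)+
  have KK: "(u, v) \<in> parcs G \<longleftrightarrow> u \<noteq> v" if "u \<in> K" "v \<in> K" for u v
    using clique that no_loops[of "(u, v)"] by (auto simp: clique_in_def pairwise_def)
  have II: "(u, v) \<notin> parcs G" if "u \<in> I" "v \<in> I" for u v
    using indep that no_loops[of "(u, v)"] by (auto simp: independent_in_def pairwise_def)
  have ends: "u \<in> K \<union> I" "v \<in> K \<union> I" if "(u, v) \<in> parcs G" for u v
    using that part in_arcsD1 in_arcsD2 by auto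
  define N where "N v = {u \<in> I. (u, v) \<in> parcs G}" for v
  have N: "finite (N v)" "u \<in> N v \<Longrightarrow> \<exists>w\<in>K. u \<notin> N w" for u v
    using finI incomplete by (auto simp: N_def)
  obtain r X where bij: "bij_betw r K {..<card K}"
    and X: "\<And>v. v \<in> K \<Longrightarrow> X v \<subseteq> N v"
    and inj: "inj_on (\<lambda>v. r v + card (X v)) K"
    and bound: "\<And>v. v \<in> K \<Longrightarrow> r v + card (X v) \<le> 2 * card K - 2"
    and distinct: "\<And>v u. v \<in> K \<Longrightarrow> u \<in> N v \<Longrightarrow>
      r v + card (X v) \<noteq> card {w \<in> K. u \<in> N w - X w}"
    by (rule exists_indegree_targets[OF finK N]) (assumption | rule that)+
  have rinj: "r u = r v \<longleftrightarrow> u = v" if "u \<in> K" "v \<in> K" for u v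
    using bij that by (auto simp: bij_betw_def inj_on_def)
  \<comment> \<open>Clique edges point to the larger rank; a cross edge enters its clique end
    \<open>v\<close> exactly when its other end lies in \<open>X v\<close>.\<close>
  define P where "P = {(u, v). (u, v) \<in> parcs G \<and>
    (u \<in> K \<and> v \<in> K \<and> r u < r v \<or> u \<in> I \<and> v \<in> K \<and> u \<in> X v \<or> u \<in> K \<and> v \<in> I \<and> v \<notin> X u)}"
  define D where "D = \<lparr>pverts = pverts G, parcs = P\<rparr>"
  have disj: "x \<in> K \<Longrightarrow> x \<notin> I" for x using part by auto
  have "(u, v) \<in> P \<longleftrightarrow> (v, u) \<notin> P" if "(u, v) \<in> parcs G" for u v
    using that sym[OF that] ends[OF that] rinj[of u v] KK[of u v] II[of u v] disj[of u] disj[of v]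
    unfolding P_def by auto
  then have orient: "orientation G D"
    by (auto simp: orientation_def D_def P_def)
  have degK: "in_degree D v = r v + card (X v)" if v: "v \<in> K" for v
  proof -
    have "{u. (u, v) \<in> P} = {u \<in> K. r u < r v} \<union> X v"
      using X[OF v] v KK disj by (auto simp: P_def N_def)
    moreover have "{u \<in> K. r u < r v} \<inter> X v = {}"
      using X[OF v] disj by (auto simp: N_def)
    moreover have "finite (X v)" using X[OF v] finI by (auto simp: N_def intro: finite_subset)
    ultimately show ?thesis
      using finK rank_eq_card_smaller[OF bij v]
      by (simp add: in_degree_eq_card D_def card_Un_disjoint)
  qed
  have degI: "in_degree D u = card {w \<in> K. u \<in> N w - X w}" if u: "u \<in> I" for u
  proof -
    have "{w. (w, u) \<in> P} = {w \<in> K. u \<in> N w - X w}"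
      using u disj sym by (auto simp: P_def N_def)
    then show ?thesis by (simp add: in_degree_eq_card D_def)
  qed
  have boundI: "in_degree D u \<le> 2 * card K - 2" if u: "u \<in> I" for u
  proof -
    have "{w \<in> K. u \<in> N w - X w} \<subset> K" using incomplete[OF u] by (auto simp: N_def)
    then have "in_degree D u < card K"
      unfolding degI[OF u] using finK by (rule psubset_card_mono[rotated])
    \<comment> \<open>The strict bound forces \<open>card K\<close> to be positive, so truncated
      subtraction is harmless.\<close>
    then show ?thesis by simp
  qed
  have KI: "in_degree D v \<noteq> in_degree D u" if "(u, v) \<in> parcs G" "v \<in> K" "u \<in> I" for u v
    using distinct[of v u] degK degI that by (simp add: N_def)
  have "in_degree D u \<noteq> in_degree D v" if uv: "(u, v) \<in> parcs G" for u v
  proof -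
    consider "u \<in> K" "v \<in> K" | "u \<in> I" "v \<in> K" | "u \<in> K" "v \<in> I"
      using ends[OF uv] II[of u v] uv by auto
    then show ?thesis
    proof cases
      case 1
      then show ?thesis using degK KK uv inj by (auto simp: inj_on_def)
    next
      case 2
      then show ?thesis using KI[OF uv] by auto
    next
      case 3
      then show ?thesis using KI[OF sym[OF uv]] by auto
    qed
  qed
  then have "proper G D" by (auto simp: proper_def)
  moreover have "k_orientation (2 * card K - 2) G D"
    using orient bound degK boundI unfolding k_orientation_def part(1)[symmetric] by auto
  ultimately show ?thesis by blast
qed

text \<open>A vertex of \<open>I\<close> adjacent to all of \<open>K\<close> can be moved into the
  clique. One move suffices, since the rest of \<open>I\<close> is not adjacent to the moved
  vertex.\<close>

lemma split_graph_incomplete_partition: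
  assumes "pair_graph G" "split_graph G"
  obtains K I where "K \<union> I = pverts G" "K \<inter> I = {}" "clique_in G K" "independent_in G I"
    "\<And>u. u \<in> I \<Longrightarrow> \<exists>w\<in>K. (u, w) \<notin> parcs G"
proof -
  interpret pair_graph G by fact
  obtain K I where KI: "K \<union> I = pverts G" "K \<inter> I = {}" "clique_in G K" "independent_in G I"
    using assms(2) by (auto simp: split_graph_def)
  show ?thesis
  proof (cases "\<exists>u\<in>I. \<forall>w\<in>K. (u, w) \<in> parcs G")
    case False
    then show ?thesis using that[OF KI] by blast
  next
    case True
    then obtain u where u: "u \<in> I" "\<forall>w\<in>K. (u, w) \<in> parcs G" by blast
    have "clique_in G (insert u K)"
      using KI(1,3) u arcs_symmetric unfolding clique_in_def pairwise_insert by blast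
    moreover have "independent_in G (I - {u})"
      using KI(4) by (auto simp: independent_in_def pairwise_def)
    moreover have "(x, u) \<notin> parcs G" if "x \<in> I - {u}" for x
      using KI(4) u that by (auto simp: independent_in_def pairwise_def)
    moreover have "insert u K \<union> (I - {u}) = pverts G" "insert u K \<inter> (I - {u}) = {}"
      using KI u by auto
    ultimately show ?thesis using that[of "insert u K" "I - {u}"] by blast
  qed
qed

lemma card_clique_le_clique_number:
  assumes "finite (pverts G)" "clique_in G K"
  shows "card K \<le> clique_number G"
proof -
  have "{K. clique_in G K} \<subseteq> Pow (pverts G)" by (auto simp: clique_in_def)
  then have "finite {K. clique_in G K}" using assms(1) by (simp add: finite_subset)
  then show ?thesis using assms(2) by (simp add: clique_number_def)
qed

theorem theorem15:
  fixes G :: "'a pair_pre_digraph"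
  assumes "pair_graph G" and "split_graph G"
  shows "proper_orientation_number G \<le> 2 * clique_number G - 2"
proof -
  interpret pair_graph G by fact
  obtain K I where KI: "K \<union> I = pverts G" "K \<inter> I = {}" "clique_in G K" "independent_in G I"
    "\<And>u. u \<in> I \<Longrightarrow> \<exists>w\<in>K. (u, w) \<notin> parcs G"
    using split_graph_incomplete_partition[OF assms] by metis
  then have "\<exists>D. k_orientation (2 * card K - 2) G D \<and> proper G D"
    using exists_proper_orientation_of_split[OF assms(1)] by blast
  then have "proper_orientation_number G \<le> 2 * card K - 2"
    unfolding proper_orientation_number_def by (rule Least_le)
  also have "\<dots> \<le> 2 * clique_number G - 2"
    using card_clique_le_clique_number[OF finite_verts KI(3)] by simp
  finally show ?thesis .
qed

end
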